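(* For all integers $r\geq2$, $\mathcal{B}_{r,1}=\mathcal{D}_{r,1}$.
   Context: A partition is a non-increasing finite sequence of positive integers (possibly empty). For a partition $\mu=(\mu_1,\dots,\mu_t)$ let $\mathrm{rect}(\mu)=\max\{h\ge0: h\le t,\ \mu_h\ge h+1\}$ (height of the horizontal Durfee rectangle, the largest rectangle with $h$ rows and $h+1$ columns in the top-left corner of the Young diagram). $\mathcal{D}_{r,1}$ is the set of partitions $\lambda$ such that, setting $\mu^{(0)}=\lambda$ and letting $\mu^{(j)}$ be $\mu^{(j-1)}$ with its first $\mathrm{rect}(\mu^{(j-1)})$ parts deleted, $\mu^{(r-1)}$ is empty. $\mathcal{B}_{r,1}$ is the set of partitions $\lambda$ such that, setting $\nu^{(0)}=\lambda$ and letting $\nu^{(j)}$ be obtained from $\nu^{(j-1)}=(\nu_1,\dots,\nu_t)$ by deleting its last $\min(\nu_t-1,t)$ parts (removal of the bottom rectangle of width $\nu_t$ and height $\nu_t-1$; nothing is done if $\nu^{(j-1)}$ is empty), $\nu^{(r-1)}$ is empty. *)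

theory Defs
  imports Main
begin

definition is_partition :: "nat list \<Rightarrow> bool" where
  "is_partition \<mu> \<longleftrightarrow> sorted_wrt (\<ge>) \<mu> \<and> (\<forall>p\<in>set \<mu>. 0 < p)"

text \<open>Lists are indexed from 0, so the part \<open>\<mu>\<^sub>h\<close> is \<open>\<mu> ! (h - 1)\<close>;
  the condition on \<open>\<mu>\<^sub>h\<close> is vacuous for \<open>h = 0\<close>.\<close>

definition rect :: "nat list \<Rightarrow> nat" where
  "rect \<mu> = Max {h. h \<le> length \<mu> \<and> (h \<ge> 1 \<longrightarrow> \<mu> ! (h - 1) \<ge> h + 1)}"

definition remove_top_rect :: "nat list \<Rightarrow> nat list" where
  "remove_top_rect \<mu> = drop (rect \<mu>) \<mu>"

definition D_set :: "nat \<Rightarrow> nat list set" where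
  "D_set r = {la. is_partition la \<and> (remove_top_rect ^^ (r - 1)) la = []}"

definition remove_bottom_rect :: "nat list \<Rightarrow> nat list" where
  "remove_bottom_rect \<nu> =
     (if \<nu> = [] then [] else take (length \<nu> - min (last \<nu> - 1) (length \<nu>)) \<nu>)"

definition B_set :: "nat \<Rightarrow> nat list set" where
  "B_set r = {la. is_partition la \<and> (remove_bottom_rect ^^ (r - 1)) la = []}"

end

theory Submission imports Defs begin

text \<open>Call a list of parts a block if it has fewer entries than its smallest part. Every
  sub-collection of a block is again a block. Removing the top rectangle deletes the longest prefix
  that is a block, removing the bottom rectangle the longest suffix that is a block. Either greedy
  procedure empties a partition within \<open>k\<close> steps iff the partition is a concatenation of \<open>k\<close>
  (possibly empty) blocks, a condition that does not see the direction of removal.\<close>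

definition rect_block :: "nat list \<Rightarrow> bool" where
  "rect_block xs \<longleftrightarrow> (\<forall>x\<in>set xs. length xs < x)"

lemma rect_block_appendD:
  assumes "rect_block (xs @ ys)"
  shows "rect_block xs" "rect_block ys"
  using assms by (auto simp: rect_block_def dest: add_lessD1 intro: le_less_trans[OF le_add2])

text \<open>Since blocks may be empty, \<open>k\<close> acts as an upper bound on the number of
  nonempty ones.\<close>

definition block_concat :: "nat \<Rightarrow> nat list \<Rightarrow> bool" where
  "block_concat k xs \<longleftrightarrow> (\<exists>bs. length bs = k \<and> concat bs = xs \<and> (\<forall>b\<in>set bs. rect_block b))"

lemma block_concat_0 [simp]: "block_concat 0 xs \<longleftrightarrow> xs = []"
  by (auto simp: block_concat_def)

lemma block_concat_Suc_front:
  "block_concat (Suc k) xs \<longleftrightarrow> (\<exists>b ys. xs = b @ ys \<and> rect_block b \<and> block_concat k ys)"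
  unfolding block_concat_def length_Suc_conv by fastforce

text \<open>The same list of blocks is split at its last entry instead of its first, so one
  predicate serves both directions of removal.\<close>

lemma block_concat_Suc_back:
  "block_concat (Suc k) xs \<longleftrightarrow> (\<exists>ys b. xs = ys @ b \<and> rect_block b \<and> block_concat k ys)"
  unfolding block_concat_def length_Suc_conv_rev by fastforce

text \<open>The cut falls inside the first block or beyond it. Inside, the surviving piece is still
  a block; beyond, induction applies to the remaining blocks.\<close>

lemma block_concat_suffix: "block_concat k (xs @ ys) \<Longrightarrow> block_concat k ys"
proof (induction k arbitrary: xs ys)
  case (Suc k)
  then obtain b zs where b: "xs @ ys = b @ zs" "rect_block b" "block_concat k zs"
    by (auto simp: block_concat_Suc_front)
  then consider us where "zs = us @ ys" | us where "b = xs @ us" "ys = us @ zs"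
    by (auto simp: append_eq_append_conv2)
  then show ?case
  proof cases
    case 1
    then have "block_concat k ys" using Suc.IH b(3) by blast
    \<comment> \<open>The first block is lost entirely; an empty block takes its place and keeps the
      count at \<open>Suc k\<close>.\<close>
    then show ?thesis
      unfolding block_concat_Suc_front by (intro exI[of _ "[]"] exI[of _ ys]) (simp add: rect_block_def)
  next
    case 2
    then show ?thesis using b rect_block_appendD(2) by (auto simp: block_concat_Suc_front)
  qed
qed simp

text \<open>Mirror image of \<open>block_concat_suffix\<close>, peeling blocks off the back.\<close>

lemma block_concat_prefix: "block_concat k (xs @ ys) \<Longrightarrow> block_concat k xs"
proof (induction k arbitrary: xs ys)
  case (Suc k)
  then obtain b zs where b: "xs @ ys = zs @ b" "rect_block b" "block_concat k zs"
    by (auto simp: block_concat_Suc_back)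
  then consider us where "zs = xs @ us" | us where "b = us @ ys" "xs = zs @ us"
    by (auto simp: append_eq_append_conv2)
  then show ?case
  proof cases
    case 1
    then have "block_concat k xs" using Suc.IH b(3) by blast
    then show ?thesis
      unfolding block_concat_Suc_back by (intro exI[of _ xs] exI[of _ "[]"]) (simp add: rect_block_def)
  next
    case 2
    then show ?thesis using b rect_block_appendD(1) by (auto simp: block_concat_Suc_back)
  qed
qed simp

text \<open>The smallest of the first \<open>h\<close> entries is the one at index
  \<open>h - 1\<close>, so one comparison decides. The right-hand side is the condition maximised in
  \<open>rect\<close>.\<close>

lemma rect_block_take_iff:
  assumes "sorted_wrt (\<ge>) \<mu>" "h \<le> length \<mu>"
  shows "rect_block (take h \<mu>) \<longleftrightarrow> (h \<ge> 1 \<longrightarrow> \<mu> ! (h - 1) \<ge> h + 1)"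
proof
  assume *: "rect_block (take h \<mu>)"
  have "\<mu> ! (h - 1) \<in> set (take h \<mu>)" if "h \<ge> 1"
    using that assms(2) by (auto simp: in_set_conv_nth intro!: exI[of _ "h - 1"])
  then show "h \<ge> 1 \<longrightarrow> \<mu> ! (h - 1) \<ge> h + 1"
    using * assms(2) by (auto simp: rect_block_def Suc_le_eq)
next
  assume *: "h \<ge> 1 \<longrightarrow> \<mu> ! (h - 1) \<ge> h + 1"
  have "h < \<mu> ! i" if "i < h" for i
  proof -
    have "\<mu> ! (h - 1) \<le> \<mu> ! i"
      using that assms sorted_wrt_nth_less[OF assms(1), of i "h - 1"]
      by (cases "i = h - 1") auto
    then show ?thesis using * that by auto
  qed
  then show "rect_block (take h \<mu>)"
    using assms(2) by (auto simp: rect_block_def in_set_conv_nth)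
qed

text \<open>All nonempty suffixes share the smallest entry \<open>last \<nu>\<close>, so only their
  length matters.\<close>

lemma rect_block_drop_iff:
  assumes "sorted_wrt (\<ge>) \<nu>" "m < length \<nu>"
  shows "rect_block (drop m \<nu>) \<longleftrightarrow> length \<nu> - m < last \<nu>"
proof
  assume *: "rect_block (drop m \<nu>)"
  have "last (drop m \<nu>) \<in> set (drop m \<nu>)" using assms(2) by (intro last_in_set) simp
  then show "length \<nu> - m < last \<nu>"
    using * assms(2) unfolding rect_block_def by (metis last_drop length_drop)
next
  assume *: "length \<nu> - m < last \<nu>"
  have ne: "\<nu> \<noteq> []" using assms(2) by auto
  have "last \<nu> \<le> x" if "x \<in> set \<nu>" for x
  proof -
    have "sorted_wrt (\<ge>) (butlast \<nu> @ [last \<nu>])" using assms(1) ne by simp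
    moreover have "x \<in> set (butlast \<nu> @ [last \<nu>])" using that ne by simp
    ultimately show ?thesis unfolding sorted_wrt_append by auto
  qed
  then show "rect_block (drop m \<nu>)"
    using * unfolding rect_block_def by (metis in_set_dropD length_drop less_le_trans)
qed

text \<open>Greedy exchange: the first block of any decomposition is no longer than the removed
  prefix, so the remainder is a suffix of the other blocks' concatenation.\<close>

lemma block_concat_remove_top_rect:
  assumes "sorted_wrt (\<ge>) \<mu>"
  shows "block_concat k (remove_top_rect \<mu>) \<longleftrightarrow> block_concat (Suc k) \<mu>"
proof -
  let ?S = "{h. h \<le> length \<mu> \<and> (h \<ge> 1 \<longrightarrow> \<mu> ! (h - 1) \<ge> h + 1)}"
  have fin: "finite ?S" by simp
  \<comment> \<open>\<open>h = 0\<close> always qualifies, so the maximum is attained.\<close>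
  have "rect \<mu> \<in> ?S" unfolding rect_def by (rule Max_in[OF fin]) auto
  then have block: "rect_block (take (rect \<mu>) \<mu>)"
    using rect_block_take_iff[OF assms] by blast
  have max: "length b \<le> rect \<mu>" if "\<mu> = b @ ys" "rect_block b" for b ys
  proof -
    have "length b \<in> ?S" using rect_block_take_iff[OF assms, of "length b"] that by simp
    then show ?thesis unfolding rect_def by (rule Max_ge[OF fin])
  qed
  show ?thesis
  proof
    assume "block_concat k (remove_top_rect \<mu>)"
    then show "block_concat (Suc k) \<mu>"
      using block unfolding block_concat_Suc_front remove_top_rect_def
      by (metis append_take_drop_id)
  next
    assume "block_concat (Suc k) \<mu>"
    then obtain b ys where b: "\<mu> = b @ ys" "rect_block b" "block_concat k ys"
      by (auto simp: block_concat_Suc_front)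
    then have "remove_top_rect \<mu> = drop (rect \<mu> - length b) ys"
      using max by (simp add: remove_top_rect_def)
    then show "block_concat k (remove_top_rect \<mu>)"
      using b(3) by (metis append_take_drop_id block_concat_suffix)
  qed
qed

text \<open>The same exchange at the other end, with the last block and
  \<open>block_concat_prefix\<close>.\<close>

lemma block_concat_remove_bottom_rect:
  assumes "sorted_wrt (\<ge>) \<nu>"
  shows "block_concat k (remove_bottom_rect \<nu>) \<longleftrightarrow> block_concat (Suc k) \<nu>"
proof -
  define m where "m = length \<nu> - min (last \<nu> - 1) (length \<nu>)"
  \<comment> \<open>For empty \<open>\<nu>\<close> both sides are \<open>[]\<close> whatever
    \<open>last []\<close> is, so the case split disappears.\<close>
  have rem: "remove_bottom_rect \<nu> = take m \<nu>"
    by (simp add: remove_bottom_rect_def m_def)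
  have block: "rect_block (drop m \<nu>)"
  proof (cases "m < length \<nu>")
    case True
    \<comment> \<open>Something is removed, so \<open>last \<nu> - 1\<close> is positive and bounds
      the removed length strictly below \<open>last \<nu>\<close>.\<close>
    then show ?thesis using rect_block_drop_iff[OF assms True] by (auto simp: m_def)
  qed (simp add: rect_block_def)
  have max: "m \<le> length ys" if "\<nu> = ys @ b" "rect_block b" for ys b
  proof (cases "b = []")
    case True
    then show ?thesis using that by (simp add: m_def)
  next
    case False
    then have "length \<nu> - length ys < last \<nu>"
      using rect_block_drop_iff[OF assms, of "length ys"] that by simp
    then show ?thesis by (auto simp: m_def)
  qed
  show ?thesis
  proof
    assume "block_concat k (remove_bottom_rect \<nu>)"
    then show "block_concat (Suc k) \<nu>"
      using block unfolding block_concat_Suc_back rem by (metis append_take_drop_id)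
  next
    assume "block_concat (Suc k) \<nu>"
    then obtain ys b where b: "\<nu> = ys @ b" "rect_block b" "block_concat k ys"
      by (auto simp: block_concat_Suc_back)
    then have "remove_bottom_rect \<nu> = take m ys" using max rem by simp
    then show "block_concat k (remove_bottom_rect \<nu>)"
      using b(3) by (metis append_take_drop_id block_concat_prefix)
  qed
qed

text \<open>Each removal is traded for one block; the remainder stays non-increasing, being a
  suffix.\<close>

lemma remove_top_rect_funpow_eq_Nil_iff:
  "sorted_wrt (\<ge>) \<mu> \<Longrightarrow> (remove_top_rect ^^ k) \<mu> = [] \<longleftrightarrow> block_concat k \<mu>"
proof (induction k arbitrary: \<mu>)
  case (Suc k)
  have "sorted_wrt (\<ge>) (remove_top_rect \<mu>)"
    using Suc.prems by (simp add: remove_top_rect_def sorted_wrt_drop)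
  then show ?case
    using Suc.IH block_concat_remove_top_rect[OF Suc.prems] by (simp add: funpow_swap1)
qed simp

lemma remove_bottom_rect_funpow_eq_Nil_iff:
  "sorted_wrt (\<ge>) \<nu> \<Longrightarrow> (remove_bottom_rect ^^ k) \<nu> = [] \<longleftrightarrow> block_concat k \<nu>"
proof (induction k arbitrary: \<nu>)
  case (Suc k)
  have "sorted_wrt (\<ge>) (remove_bottom_rect \<nu>)"
    using Suc.prems by (simp add: remove_bottom_rect_def sorted_wrt_take)
  then show ?case
    using Suc.IH block_concat_remove_bottom_rect[OF Suc.prems] by (simp add: funpow_swap1)
qed simp

theorem theorem3p5:
  fixes r :: nat
  assumes "r \<ge> 2"
  shows "B_set r = D_set r"
  by (auto simp: B_set_def D_set_def is_partition_def
      remove_top_rect_funpow_eq_Nil_iff remove_bottom_rect_funpow_eq_Nil_iff)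

end
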